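(* Let $\tilde y\in\mathbb{R}^{2n-1}$. If $y$ is a vertex of the polyhedron $[\tilde y]$, then $\partial F(y)$ contains at least one nonsingular matrix. In particular, the maximal matrix $V\in\partial F(y)$ is nonsingular.
   Context: Fix $n\ge 1$ and $\hat X\in\mathbb{R}^{n\times n}$. $\operatorname{vec}$ stacks the columns of a matrix, $\operatorname{Mat}$ is its inverse, $\hat x=\operatorname{vec}(\hat X)$. Let $e$ be the all-ones vector, let $A\in\mathbb{R}^{(2n-1)\times n^2}$ consist of the first $2n-1$ rows of $\begin{bmatrix} I_n\otimes e^T\\ e^T\otimes I_n\end{bmatrix}$, and let $b\in\mathbb{R}^{2n-1}$ be the all-ones vector. $v_+$ is the entrywise positive part of $v$, and $F(y)=A(\hat x+A^Ty)_+-b$. $\partial F(y)$ is Clarke's generalized Jacobian: the convex hull of all limits $\lim F'(y_i)$ with $y_i\to y$ and $F$ differentiable at each $y_i$. The maximal matrix $V\in\partial F(y)$ is $V=A\,\operatorname{Diag}(\operatorname{vec}(M))A^T$, where $M\in\{0,1\}^{n\times n}$ has $M_{ij}=1$ if $\operatorname{Mat}(\hat x+A^Ty)_{ij}\ge0$ and $M_{ij}=0$ otherwise. Define $y\sim y'$ iff $(\hat x+A^Ty)_+=(\hat x+A^Ty')_+$, and $[\tilde y]=\{y\in\mathbb{R}^{2n-1}:y\sim\tilde y\}$, which is a polyhedron. *)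

theory Defs
  imports "HOL-Analysis.Analysis"
begin

text \<open>
  The index set \<open>{1..n\<^sup>2}\<close> is modelled by \<open>'n \<times> 'n\<close>, the pair \<open>(j, i)\<close> standing
  for position \<open>(j - 1) * n + i\<close> (major index first). This convention is shared by the
  column-stacking operator and by the Kronecker product.
\<close>

definition vec_of :: "real^'n^'n \<Rightarrow> real^('n::finite \<times> 'n)" where
  "vec_of X = (\<chi> p. X $ snd p $ fst p)"

definition mat_of :: "real^('n::finite \<times> 'n) \<Rightarrow> real^'n^'n" where
  "mat_of v = (\<chi> i j. v $ (j, i))"

lemma mat_of_vec_of [simp]: "mat_of (vec_of X) = X"
  by (simp add: mat_of_def vec_of_def vec_eq_iff)

lemma vec_of_mat_of [simp]: "vec_of (mat_of v) = v"
  by (simp add: mat_of_def vec_of_def vec_eq_iff)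

definition kronecker ::
    "real^'q^'p \<Rightarrow> real^'s^'r \<Rightarrow> real^('q::finite \<times> 's::finite)^('p::finite \<times> 'r::finite)" where
  "kronecker B C = (\<chi> i j. B $ fst i $ fst j * C $ snd i $ snd j)"

definition stack_rows :: "real^'k^'p \<Rightarrow> real^'k^'q \<Rightarrow> real^'k^('p::finite + 'q::finite)" where
  "stack_rows B C = (\<chi> r. case r of Inl i \<Rightarrow> B $ i | Inr i \<Rightarrow> C $ i)"

definition diag :: "real^'k \<Rightarrow> real^'k^'k::finite" where
  "diag v = (\<chi> i j. if i = j then v $ i else 0)"

definition pos_part :: "real^'k \<Rightarrow> real^'k::finite" where
  "pos_part v = (\<chi> i. max 0 (v $ i))"

definition stacked :: "real^('n \<times> 'n)^(('n::finite \<times> 1) + (1 \<times> 'n))" where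
  "stacked = stack_rows (kronecker (mat 1 :: real^'n^'n) (rowvector 1 :: real^'n^1))
                        (kronecker (rowvector 1 :: real^'n^1) (mat 1 :: real^'n^'n))"

text \<open>
  Rows are counted from 0 along the linear order of a finite index type; the rows of
  the upper block come first. For \<open>CARD('m) = 2 * CARD('n) - 1\<close> the matrix \<open>A_mat\<close>
  below thus consists of all rows of \<open>stacked\<close> except the last one.
\<close>

definition position :: "'a::{finite,linorder} \<Rightarrow> nat" where
  "position i = card {..<i}"

definition nth_index :: "nat \<Rightarrow> 'a::{finite,linorder}" where
  "nth_index k = sorted_list_of_set UNIV ! k"

definition nth_row_index :: "nat \<Rightarrow> ('n::{finite,linorder} \<times> 1) + (1 \<times> 'n)" where
  "nth_row_index k =
     (if k < CARD('n) then Inl (nth_index k, 1) else Inr (1, nth_index (k - CARD('n))))"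

definition A_mat :: "real^('n::{finite,linorder} \<times> 'n)^'m::{finite,linorder}" where
  "A_mat = (\<chi> r. stacked $ nth_row_index (position r))"

definition residual :: "real^'n::{finite,linorder}^'n::{finite,linorder} \<Rightarrow> real^'m::{finite,linorder} \<Rightarrow>
    real^('n::{finite,linorder} \<times> 'n)" where
  "residual Xh y = vec_of Xh + transpose (A_mat :: real^('n \<times> 'n)^'m::{finite,linorder}) *v y"

text \<open>On vector types \<open>1\<close> is the all-ones vector; here it plays the role of \<open>b\<close>.\<close>

definition F_map :: "real^'n::{finite,linorder}^'n::{finite,linorder} \<Rightarrow> real^'m::{finite,linorder} \<Rightarrow> real^'m::{finite,linorder}" where
  "F_map Xh y = A_mat *v pos_part (residual Xh y) - 1"

definition clarke_jacobian :: "(real^'a \<Rightarrow> real^'b) \<Rightarrow> real^'a \<Rightarrow> (real^'a::finite^'b::finite) set" where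
  "clarke_jacobian f y = convex hull
     {V. \<exists>s. (\<forall>k. f differentiable (at (s k))) \<and> s \<longlonglongrightarrow> y \<and>
             (\<lambda>k. jacobian f (at (s k))) \<longlonglongrightarrow> V}"

definition max_M :: "real^'n::{finite,linorder}^'n::{finite,linorder} \<Rightarrow> real^'m::{finite,linorder} \<Rightarrow> real^'n::{finite,linorder}^'n::{finite,linorder}" where
  "max_M Xh y = (\<chi> i j. if mat_of (residual Xh y) $ i $ j \<ge> 0 then 1 else 0)"

definition max_V :: "real^'n::{finite,linorder}^'n::{finite,linorder} \<Rightarrow> real^'m::{finite,linorder} \<Rightarrow> real^'m::{finite,linorder}^'m::{finite,linorder}" where
  "max_V Xh y = (A_mat :: real^('n \<times> 'n)^'m::{finite,linorder}) ** diag (vec_of (max_M Xh y)) ** transpose A_mat"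

definition equivalent :: "real^'n::{finite,linorder}^'n::{finite,linorder} \<Rightarrow> real^'m::{finite,linorder} \<Rightarrow> real^'m::{finite,linorder} \<Rightarrow> bool" where
  "equivalent Xh y y' \<longleftrightarrow> pos_part (residual Xh y) = pos_part (residual Xh y')"

definition equiv_class :: "real^'n::{finite,linorder}^'n::{finite,linorder} \<Rightarrow> real^'m::{finite,linorder} \<Rightarrow> (real^'m::{finite,linorder}) set" where
  "equiv_class Xh yt = {y. equivalent Xh y yt}"

end

theory Submission
  imports Defs
begin

text \<open>
  Let \<open>r\<close> be the residual at \<open>y\<close>, let \<open>A\<close> be the constraint matrix, and let \<open>D\<close> be the diagonal
  0/1 matrix that selects the coordinates with \<open>r\<^sub>p \<ge> 0\<close>, so that the maximal matrix is
  \<open>V = A D A\<^sup>T\<close>. Two perturbations of \<open>y\<close> give the result; both leave the strictly negative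
  coordinates of the residual negative, because there are finitely many of them.

  \<^item> Every column of \<open>A\<close> is nonnegative and nonzero, hence the all-ones vector \<open>d\<close> satisfies
    \<open>A\<^sup>T d > 0\<close> in every coordinate. Moving from \<open>y\<close> a little in the direction \<open>d\<close> makes the coordinates with
    \<open>r\<^sub>p \<ge> 0\<close> positive. At such a point no coordinate of the residual vanishes,
    so \<open>F\<close> is locally affine there, with Jacobian exactly \<open>V\<close>. Letting the step tend to 0 shows
    that \<open>V\<close> is a limit of Jacobians (\<open>max_jacobian_in_clarke_jacobian\<close>).

  \<^item> If \<open>V z = 0\<close>, then \<open>0 = z\<^sup>T V z\<close> is the sum of the \<open>(A\<^sup>T z)\<^sub>p\<^sup>2\<close> over the coordinates with
    \<open>r\<^sub>p \<ge> 0\<close>. So moving along \<open>\<plusminus>z\<close> fixes these coordinates of the residual, and a short move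
    keeps the others negative: the positive part does not change. Thus \<open>y\<close> is the midpoint of
    two points of its own class, and extremality forces \<open>z = 0\<close>
    (\<open>max_jacobian_invertible\<close>).
\<close>

section \<open>Positive parts of affine maps\<close>

definition nonneg_indicator :: "real^'k \<Rightarrow> real^'k::finite" where
  "nonneg_indicator v = (\<chi> i. if v $ i \<ge> 0 then 1 else 0)"

lemma diag_mult_vec: "diag v *v w = (\<chi> i. v $ i * w $ i)"
  by (simp add: diag_def matrix_vector_mult_def vec_eq_iff if_distrib[of "\<lambda>x. x * _"] cong: if_cong)

text \<open>Away from the coordinate hyperplanes the sign pattern is locally constant, so the positive
  part agrees near \<open>v\<close> with a linear coordinate projection.\<close>

lemma pos_part_has_derivative:
  fixes v :: "real^'k::finite"
  assumes "\<And>i. v $ i \<noteq> 0"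
  shows "(pos_part has_derivative (\<lambda>h. diag (nonneg_indicator v) *v h)) (at v)"
proof -
  let ?D = "diag (nonneg_indicator v)"
  let ?S = "\<Inter>i. {w::real^'k. 0 < w $ i * v $ i}"
  have "open {w::real^'k. 0 < w $ i * v $ i}" for i
    by (intro open_Collect_less continuous_intros)
  then have "open ?S"
    by (intro open_INT) auto
  moreover have "v \<in> ?S"
    using assms by (auto simp: zero_less_mult_iff neq_iff)
  moreover have "?D *v w = pos_part w" if "w \<in> ?S" for w
  proof -
    have "nonneg_indicator v $ i * w $ i = max 0 (w $ i)" for i
    proof -
      have "0 < w $ i * v $ i" using that by blast
      then show ?thesis
        by (auto simp: nonneg_indicator_def zero_less_mult_iff)
    qed
    then show ?thesis
      by (simp add: diag_mult_vec pos_part_def)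
  qed
  moreover have "((\<lambda>w. ?D *v w) has_derivative (\<lambda>h. ?D *v h)) (at v)"
    by (intro bounded_linear_imp_has_derivative matrix_vector_mul_bounded_linear)
  ultimately show ?thesis
    using has_derivative_transform_within_open by blast
qed

lemma pos_part_affine_has_derivative:
  fixes A :: "real^'k::finite^'m::finite" and x :: "real^'k"
  assumes "\<And>p. (x + transpose A *v u) $ p \<noteq> 0"
  shows "((\<lambda>u. A *v pos_part (x + transpose A *v u) - c) has_derivative
          (\<lambda>h. (A ** diag (nonneg_indicator (x + transpose A *v u)) ** transpose A) *v h)) (at u)"
proof -
  let ?D = "diag (nonneg_indicator (x + transpose A *v u))"
  have inner: "((\<lambda>u. x + transpose A *v u) has_derivative (\<lambda>h. transpose A *v h)) (at u)"
    using has_derivative_add[OF has_derivative_const[of x]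
        bounded_linear_imp_has_derivative[OF matrix_vector_mul_bounded_linear[of "transpose A"]]]
    by (simp del: transpose_matrix_vector)
  have "((\<lambda>u. pos_part (x + transpose A *v u)) has_derivative
        (\<lambda>h. ?D *v (transpose A *v h))) (at u)"
    using has_derivative_compose[OF inner pos_part_has_derivative[OF assms]] .
  then have "((\<lambda>u. A *v pos_part (x + transpose A *v u)) has_derivative
        (\<lambda>h. A *v (?D *v (transpose A *v h)))) (at u)"
    by (rule bounded_linear.has_derivative[OF matrix_vector_mul_bounded_linear])
  then have "((\<lambda>u. A *v pos_part (x + transpose A *v u) - c) has_derivative
        (\<lambda>h. A *v (?D *v (transpose A *v h)) - 0)) (at u)"
    by (intro has_derivative_diff has_derivative_const)
  then show ?thesis
    by (simp add: matrix_vector_mul_assoc matrix_mul_assoc del: transpose_matrix_vector)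
qed

lemma negative_coordinates_stable:
  fixes r w :: "real^'k::finite"
  obtains \<delta> where "\<delta> > 0"
    and "\<And>t p. \<bar>t\<bar> \<le> \<delta> \<Longrightarrow> r $ p < 0 \<Longrightarrow> r $ p + t * w $ p < 0"
proof -
  have "\<forall>\<^sub>F t in nhds 0. \<forall>p. r $ p < 0 \<longrightarrow> r $ p + t * w $ p < 0"
  proof (rule eventually_all_finite)
    fix p
    have "((\<lambda>t. r $ p + t * w $ p) \<longlongrightarrow> r $ p + 0 * w $ p) (nhds 0)"
      by (intro tendsto_intros filterlim_ident)
    then show "\<forall>\<^sub>F t in nhds 0. r $ p < 0 \<longrightarrow> r $ p + t * w $ p < 0"
      by (cases "r $ p < 0") (auto dest: order_tendstoD(2))
  qed
  then obtain e where e: "e > 0"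
    "\<And>t p. dist t 0 < e \<Longrightarrow> r $ p < 0 \<Longrightarrow> r $ p + t * w $ p < 0"
    unfolding eventually_nhds_metric by blast
  show thesis
    by (rule that[of "e / 2"]) (use e in auto)
qed

section \<open>The maximal matrix as a limit of Jacobians\<close>

text \<open>The hypothesis on \<open>d\<close> is what makes the maximal matrix attainable: along \<open>d\<close>
  every vanishing coordinate of \<open>x + A\<^sup>T y\<close> becomes positive.\<close>

lemma max_jacobian_in_clarke_jacobian:
  fixes A :: "real^'k::finite^'m::finite" and x :: "real^'k" and y d :: "real^'m"
  assumes d: "\<And>p. (transpose A *v d) $ p > 0"
  shows "A ** diag (nonneg_indicator (x + transpose A *v y)) ** transpose A
    \<in> clarke_jacobian (\<lambda>u. A *v pos_part (x + transpose A *v u) - c) y"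
    (is "?V \<in> clarke_jacobian ?F y")
proof -
  let ?r = "x + transpose A *v y"
  let ?w = "transpose A *v d"
  obtain \<delta> where \<delta>: "\<delta> > 0"
    "\<And>t p. \<bar>t\<bar> \<le> \<delta> \<Longrightarrow> ?r $ p < 0 \<Longrightarrow> ?r $ p + t * ?w $ p < 0"
    using negative_coordinates_stable[of ?r ?w] by metis
  define t where "t k = \<delta> * inverse (real (Suc k))" for k
  define s where "s k = y + t k *\<^sub>R d" for k
  have t: "0 < t k" "\<bar>t k\<bar> \<le> \<delta>" for k
    using \<delta>(1) by (auto simp: t_def field_simps)
  have coord: "(x + transpose A *v s k) $ p = ?r $ p + t k * ?w $ p" for k p
    by (simp add: s_def matrix_vector_right_distrib matrix_vector_mult_scaleR)
  have sign: "(x + transpose A *v s k) $ p > 0 \<longleftrightarrow> ?r $ p \<ge> 0"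
    and nonzero: "(x + transpose A *v s k) $ p \<noteq> 0" for k p
  proof -
    show "(x + transpose A *v s k) $ p > 0 \<longleftrightarrow> ?r $ p \<ge> 0"
      using \<delta>(2)[OF t(2), of p k] mult_pos_pos[OF t(1) d, of k p] unfolding coord by linarith
    show "(x + transpose A *v s k) $ p \<noteq> 0"
      using \<delta>(2)[OF t(2), of p k] mult_pos_pos[OF t(1) d, of k p] unfolding coord by linarith
  qed
  have "(x + transpose A *v s k) $ p \<ge> 0 \<longleftrightarrow> ?r $ p \<ge> 0" for k p
    using sign[where k=k and p=p] nonzero[where k=k and p=p] by linarith
  then have "nonneg_indicator (x + transpose A *v s k) = nonneg_indicator ?r" for k
    unfolding nonneg_indicator_def by simp
  then have deriv: "(?F has_derivative (\<lambda>h. ?V *v h)) (at (s k))" for k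
    using pos_part_affine_has_derivative[of x A "s k" c, OF nonzero] by simp
  then have "jacobian ?F (at (s k)) = ?V" for k
    by (metis frechet_derivative_at jacobian_def matrix_of_matrix_vector_mul)
  moreover have "?F differentiable (at (s k))" for k
    using deriv unfolding differentiable_def by blast
  moreover have "s \<longlonglongrightarrow> y"
  proof -
    have "t \<longlonglongrightarrow> \<delta> * 0"
      unfolding t_def by (intro tendsto_mult tendsto_const LIMSEQ_inverse_real_of_nat)
    then have "s \<longlonglongrightarrow> y + 0 *\<^sub>R d"
      unfolding s_def by (intro tendsto_intros) simp
    then show ?thesis by simp
  qed
  ultimately show ?thesis
    unfolding clarke_jacobian_def
    by (intro hull_inc CollectI exI[of _ s]) (simp del: transpose_matrix_vector)
qed

section \<open>Nonsingularity at a vertex\<close>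

lemma quadratic_form_diag:
  fixes A :: "real^'k::finite^'m::finite"
  shows "z \<bullet> ((A ** diag v ** transpose A) *v z) = (\<Sum>p\<in>UNIV. v $ p * ((transpose A *v z) $ p)\<^sup>2)"
proof -
  have "z \<bullet> ((A ** diag v ** transpose A) *v z) = z \<bullet> (A *v (diag v *v (transpose A *v z)))"
    by (simp add: matrix_vector_mul_assoc matrix_mul_assoc del: transpose_matrix_vector)
  also have "\<dots> = (transpose A *v z) \<bullet> (diag v *v (transpose A *v z))"
    by (simp add: dot_lmul_matrix[symmetric])
  finally show ?thesis
    by (simp add: inner_vec_def diag_mult_vec power2_eq_square algebra_simps)
qed

text \<open>A kernel vector of the maximal matrix is a direction along which the positive part is
  locally constant on both sides of \<open>y\<close>, so an extreme point admits only the zero one.\<close>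

lemma max_jacobian_invertible:
  fixes A :: "real^'k::finite^'m::finite" and x :: "real^'k" and y :: "real^'m"
  assumes extreme: "y extreme_point_of
      {u. pos_part (x + transpose A *v u) = pos_part (x + transpose A *v y)}"
      (is "y extreme_point_of ?C")
  shows "invertible (A ** diag (nonneg_indicator (x + transpose A *v y)) ** transpose A)"
    (is "invertible ?V")
proof -
  let ?r = "x + transpose A *v y"
  have "z = 0" if ker: "?V *v z = 0" for z
  proof (rule ccontr)
    assume "z \<noteq> 0"
    let ?w = "transpose A *v z"
    have "(\<Sum>p\<in>UNIV. nonneg_indicator ?r $ p * (?w $ p)\<^sup>2) = 0"
      using quadratic_form_diag[of z A "nonneg_indicator ?r"] ker by simp
    then have "\<forall>p. nonneg_indicator ?r $ p * (?w $ p)\<^sup>2 = 0"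
      by (subst (asm) sum_nonneg_eq_0_iff) (auto simp: nonneg_indicator_def)
    then have fixed: "?w $ p = 0" if "?r $ p \<ge> 0" for p
      using that by (auto simp: nonneg_indicator_def split: if_splits)
    obtain \<delta> where \<delta>: "\<delta> > 0"
      "\<And>t p. \<bar>t\<bar> \<le> \<delta> \<Longrightarrow> ?r $ p < 0 \<Longrightarrow> ?r $ p + t * ?w $ p < 0"
      using negative_coordinates_stable[of ?r ?w] by metis
    have move: "y + t *\<^sub>R z \<in> ?C" if "\<bar>t\<bar> \<le> \<delta>" for t
    proof -
      have "(x + transpose A *v (y + t *\<^sub>R z)) $ p = ?r $ p + t * ?w $ p" for p
        by (simp add: matrix_vector_right_distrib matrix_vector_mult_scaleR)
      moreover have "max 0 (?r $ p + t * ?w $ p) = max 0 (?r $ p)" for p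
        using fixed[of p] \<delta>(2)[OF that, of p] by (cases "?r $ p \<ge> 0") auto
      ultimately show ?thesis
        by (simp add: pos_part_def del: transpose_matrix_vector vector_add_component)
    qed
    have "y + \<delta> *\<^sub>R z \<in> ?C" "y + (- \<delta>) *\<^sub>R z \<in> ?C"
      using \<delta>(1) by (intro move; simp)+
    moreover have "y \<in> open_segment (y + \<delta> *\<^sub>R z) (y + (- \<delta>) *\<^sub>R z)"
    proof -
      have "y = midpoint (y + \<delta> *\<^sub>R z) (y + (- \<delta>) *\<^sub>R z)"
        by (simp add: midpoint_def scaleR_2[symmetric])
      moreover have "y + \<delta> *\<^sub>R z \<noteq> y + (- \<delta>) *\<^sub>R z"
        using \<open>z \<noteq> 0\<close> \<delta>(1) by (simp add: eq_neg_iff_add_eq_0 flip: scaleR_add_left)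
      ultimately show ?thesis
        by (metis midpoint_in_open_segment)
    qed
    ultimately show False
      using extreme unfolding extreme_point_of_def by blast
  qed
  then show ?thesis
    by (simp add: invertible_left_inverse matrix_left_invertible_ker)
qed

section \<open>The constraint matrix\<close>

lemma position_nth_index:
  assumes "k < CARD('a::{finite,linorder})"
  shows "position (nth_index k :: 'a) = k"
proof -
  let ?xs = "sorted_list_of_set (UNIV :: 'a set)"
  have len: "length ?xs = CARD('a)" by simp
  have mono: "?xs ! i < ?xs ! j" if "i < j" "j < CARD('a)" for i j
    using that strict_sorted_list_of_set[of "UNIV :: 'a set"] len
    by (auto simp: sorted_wrt_iff_nth_less)
  have less: "?xs ! i < ?xs ! j \<longleftrightarrow> i < j" if "i < CARD('a)" "j < CARD('a)" for i j
    using mono[of i j] mono[of j i] that by (cases i j rule: linorder_cases) auto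
  have "{..<?xs ! k} = (!) ?xs ` {..<k}"
  proof (intro set_eqI iffI)
    fix a assume a: "a \<in> {..<?xs ! k}"
    have "a \<in> set ?xs" by simp
    then obtain i where "i < CARD('a)" "a = ?xs ! i"
      using len by (metis in_set_conv_nth)
    then show "a \<in> (!) ?xs ` {..<k}"
      using a less assms by auto
  qed (use less assms in auto)
  moreover have "inj_on ((!) ?xs) {..<k}"
    using assms by (intro inj_on_nth) auto
  ultimately show ?thesis
    by (simp add: position_def nth_index_def card_image)
qed

lemma nth_index_position:
  fixes a :: "'a::{finite,linorder}"
  shows "position a < CARD('a)" and "nth_index (position a) = a"
proof -
  have "a \<in> set (sorted_list_of_set UNIV)" by simp
  then obtain i where "i < CARD('a)" "a = nth_index i"
    unfolding nth_index_def by (metis in_set_conv_nth length_sorted_list_of_set)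
  then show "position a < CARD('a)" and "nth_index (position a) = a"
    by (simp_all add: position_nth_index)
qed

lemma A_mat_nonneg:
  "(A_mat :: real^('n::{finite,linorder} \<times> 'n)^'m::{finite,linorder}) $ r $ p \<ge> 0"
  by (auto simp: A_mat_def stacked_def stack_rows_def kronecker_def mat_def rowvector_def
      split: sum.split)

text \<open>The variable \<open>(j, i)\<close> occurs in constraint number \<open>j\<close> of the upper block, and that block
  survives the deletion of the last row because \<open>n \<le> 2 n - 1\<close>.\<close>

lemma A_mat_column_positive_entry:
  fixes p :: "'n::{finite,linorder} \<times> 'n"
  assumes "CARD('m::{finite,linorder}) = 2 * CARD('n::{finite,linorder}) - 1"
  obtains r where "(A_mat :: real^('n::{finite,linorder} \<times> 'n)^'m::{finite,linorder}) $ r $ p > 0"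
proof -
  have pos: "position (fst p) < CARD('n)"
    by (rule nth_index_position)
  moreover from this have "position (fst p) < CARD('m)"
    using assms by simp
  ultimately have "nth_row_index (position (nth_index (position (fst p)) :: 'm)) = Inl (fst p, 1)"
    by (simp add: nth_row_index_def position_nth_index nth_index_position)
  then have "(A_mat :: real^('n::{finite,linorder} \<times> 'n)^'m::{finite,linorder}) $ nth_index (position (fst p)) $ p = 1"
    by (simp add: A_mat_def stacked_def stack_rows_def kronecker_def mat_def rowvector_def)
  then show thesis
    using that[of "nth_index (position (fst p))"] by simp
qed

lemma transpose_A_mat_ones_positive:
  assumes "CARD('m::{finite,linorder}) = 2 * CARD('n::{finite,linorder}) - 1"
  shows "(transpose (A_mat :: real^('n::{finite,linorder} \<times> 'n)^'m::{finite,linorder}) *v 1) $ p > 0"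
proof -
  obtain r where "(A_mat :: real^('n::{finite,linorder} \<times> 'n)^'m::{finite,linorder}) $ r $ p > 0"
    using A_mat_column_positive_entry[OF assms] .
  then have "0 < (\<Sum>r\<in>UNIV. (A_mat :: real^('n::{finite,linorder} \<times> 'n)^'m::{finite,linorder}) $ r $ p)"
    by (intro sum_pos2[of _ r]) (auto simp: A_mat_nonneg)
  then show ?thesis
    by (simp add: matrix_vector_mult_def transpose_def)
qed

lemma max_V_eq:
  fixes y :: "real^'m::{finite,linorder}"
  shows "max_V Xh y = A_mat ** diag (nonneg_indicator (vec_of Xh + transpose A_mat *v y))
    ** transpose A_mat"
proof -
  have "vec_of (max_M Xh y) = nonneg_indicator (residual Xh y)"
    by (simp add: vec_of_def max_M_def mat_of_def nonneg_indicator_def vec_eq_iff)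
  then show ?thesis
    by (simp add: max_V_def residual_def)
qed

theorem corollary3p11:
  fixes Xh :: "real^'n::{finite,linorder}^'n::{finite,linorder}"
    and yt y :: "real^'m::{finite,linorder}"
  assumes dim: "CARD('m) = 2 * CARD('n) - 1"
    and vertex: "y extreme_point_of (equiv_class Xh yt)"
  shows "(\<exists>W \<in> clarke_jacobian (F_map Xh) y. invertible W) \<and>
         max_V Xh y \<in> clarke_jacobian (F_map Xh) y \<and> invertible (max_V Xh y)"
proof -
  have "y \<in> equiv_class Xh yt"
    using vertex by (simp add: extreme_point_of_def)
  then have "equiv_class Xh yt = {u. pos_part (vec_of Xh + transpose A_mat *v u)
      = pos_part (vec_of Xh + transpose A_mat *v y)}"
    by (auto simp: equiv_class_def equivalent_def residual_def)
  then have inv: "invertible (max_V Xh y)"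
    using vertex max_jacobian_invertible[of y "vec_of Xh" A_mat] by (simp add: max_V_eq)
  have "F_map Xh = (\<lambda>u::real^'m::{finite,linorder}. A_mat *v pos_part (vec_of Xh + transpose A_mat *v u) - 1)"
    by (simp add: F_map_def residual_def fun_eq_iff)
  then have "max_V Xh y \<in> clarke_jacobian (F_map Xh) y"
    using max_jacobian_in_clarke_jacobian[OF transpose_A_mat_ones_positive[OF dim]]
    by (simp add: max_V_eq)
  with inv show ?thesis by blast
qed

end
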